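(* Let $N$ be a Nijenhuis operator on a compatible pre-Lie algebra $(\mathfrak g,\cdot,\ast)$ over a field $\mathbb K$. Then an infinitesimal deformation $(\mathfrak g,\cdot_t,\ast_t)$ of $(\mathfrak g,\cdot,\ast)$ is generated by the pair $(\omega_1,\omega_2)$ defined by $$\omega_1(x,y)=N(x)\cdot y+x\cdot N(y)-N(x\cdot y),\qquad \omega_2(x,y)=N(x)\ast y+x\ast N(y)-N(x\ast y)$$ for all $x,y\in\mathfrak g$. Furthermore, this infinitesimal deformation is trivial.
   Context: Pre-Lie algebra: a vector space with a bilinear product $\cdot$ satisfying $(x\cdot y)\cdot z-x\cdot(y\cdot z)=(y\cdot x)\cdot z-y\cdot(x\cdot z)$. Compatible pre-Lie algebra: a triple $(\mathfrak g,\cdot,\ast)$ where $\cdot$ and $\ast$ are pre-Lie products on $\mathfrak g$ such that for all $x,y,z$: $(x\ast y)\cdot z+(x\cdot y)\ast z-x\cdot(y\ast z)-x\ast(y\cdot z)-(y\ast x)\cdot z-(y\cdot x)\ast z+y\cdot(x\ast z)+y\ast(x\cdot z)=0$. A homomorphism of compatible pre-Lie algebras is a linear map preserving both products. Infinitesimal deformation: a pair $(\omega_1,\omega_2)$ of elements of $\mathrm{Hom}(\otimes^2\mathfrak g,\mathfrak g)$ generates an infinitesimal deformation of $(\mathfrak g,\cdot,\ast)$ if for all $t\in\mathbb K$ the products $x\cdot_ty=x\cdot y+t\omega_1(x,y)$, $x\ast_ty=x\ast y+t\omega_2(x,y)$ make $(\mathfrak g,\cdot_t,\ast_t)$ a compatible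 pre-Lie algebra. It is trivial if there is a linear operator $N'\in\mathfrak{gl}(\mathfrak g)$ such that $\mathrm{Id}+tN'$ is a compatible pre-Lie algebra homomorphism from $(\mathfrak g,\cdot_t,\ast_t)$ to $(\mathfrak g,\cdot,\ast)$ for all $t\in\mathbb K$. Nijenhuis operator: $N\in\mathfrak{gl}(\mathfrak g)$ is a Nijenhuis operator on a pre-Lie algebra $(\mathfrak g,\cdot)$ if $N(x)\cdot N(y)=N\big(N(x)\cdot y+x\cdot N(y)-N(x\cdot y)\big)$ for all $x,y$; it is a Nijenhuis operator on the compatible pre-Lie algebra $(\mathfrak g,\cdot,\ast)$ if it is a Nijenhuis operator on both $(\mathfrak g,\cdot)$ and $(\mathfrak g,\ast)$. *)

theory Defs
  imports Complex_Main
begin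

text \<open>
  Multilinear products are curried functions on a vector space given by its scalar
  multiplication; no restriction is put on the ground field or on the dimension.
  The constant \<^const>\<open>Vector_Spaces.linear\<close> is the notion over an arbitrary field.
\<close>

text \<open>Elements of Hom(V \<open>\<otimes>\<close> V, V).\<close>

locale bilinear_operation = vector_space scale
  for scale :: "'k::field \<Rightarrow> 'g::ab_group_add \<Rightarrow> 'g" +
  fixes m :: "'g \<Rightarrow> 'g \<Rightarrow> 'g"
  assumes linear_left: "Vector_Spaces.linear scale scale (\<lambda>x. m x y)"
    and linear_right: "Vector_Spaces.linear scale scale (\<lambda>y. m x y)"

locale pre_Lie_algebra = bilinear_operation scale m
  for scale :: "'k::field \<Rightarrow> 'g::ab_group_add \<Rightarrow> 'g" and m :: "'g \<Rightarrow> 'g \<Rightarrow> 'g" +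
  assumes pre_Lie: "m (m x y) z - m x (m y z) = m (m y x) z - m y (m x z)"

locale compatible_pre_Lie_algebra =
  dot: pre_Lie_algebra scale dot + ast: pre_Lie_algebra scale ast
  for scale :: "'k::field \<Rightarrow> 'g::ab_group_add \<Rightarrow> 'g"
    and dot :: "'g \<Rightarrow> 'g \<Rightarrow> 'g" and ast :: "'g \<Rightarrow> 'g \<Rightarrow> 'g" +
  assumes compatible:
    "dot (ast x y) z + ast (dot x y) z - dot x (ast y z) - ast x (dot y z)
      - dot (ast y x) z - ast (dot y x) z + dot y (ast x z) + ast y (dot x z) = 0"

locale compatible_pre_Lie_hom =
  source: compatible_pre_Lie_algebra scale dot ast +
  target: compatible_pre_Lie_algebra scale' dot' ast' +
  Vector_Spaces.linear scale scale' f
  for scale :: "'k::field \<Rightarrow> 'g::ab_group_add \<Rightarrow> 'g"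
    and dot :: "'g \<Rightarrow> 'g \<Rightarrow> 'g" and ast :: "'g \<Rightarrow> 'g \<Rightarrow> 'g"
    and scale' :: "'k \<Rightarrow> 'h::ab_group_add \<Rightarrow> 'h"
    and dot' :: "'h \<Rightarrow> 'h \<Rightarrow> 'h" and ast' :: "'h \<Rightarrow> 'h \<Rightarrow> 'h"
    and f :: "'g \<Rightarrow> 'h" +
  assumes hom_dot: "f (dot x y) = dot' (f x) (f y)"
    and hom_ast: "f (ast x y) = ast' (f x) (f y)"

definition deformed_product ::
  "('k::field \<Rightarrow> 'g::ab_group_add \<Rightarrow> 'g) \<Rightarrow> ('g \<Rightarrow> 'g \<Rightarrow> 'g) \<Rightarrow> ('g \<Rightarrow> 'g \<Rightarrow> 'g) \<Rightarrow> 'k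
    \<Rightarrow> 'g \<Rightarrow> 'g \<Rightarrow> 'g"
  where "deformed_product scale m \<omega> t = (\<lambda>x y. m x y + scale t (\<omega> x y))"

text \<open>
  The parameter \<open>t\<close> ranges over the elements of the ground field, which may be finite;
  it is not a formal variable.
\<close>

definition generates_infinitesimal_deformation ::
  "('k::field \<Rightarrow> 'g::ab_group_add \<Rightarrow> 'g) \<Rightarrow> ('g \<Rightarrow> 'g \<Rightarrow> 'g) \<Rightarrow> ('g \<Rightarrow> 'g \<Rightarrow> 'g)
    \<Rightarrow> ('g \<Rightarrow> 'g \<Rightarrow> 'g) \<Rightarrow> ('g \<Rightarrow> 'g \<Rightarrow> 'g) \<Rightarrow> bool"
  where "generates_infinitesimal_deformation scale dot ast \<omega>1 \<omega>2 \<longleftrightarrow>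
    bilinear_operation scale \<omega>1 \<and> bilinear_operation scale \<omega>2 \<and>
    (\<forall>t. compatible_pre_Lie_algebra scale
           (deformed_product scale dot \<omega>1 t) (deformed_product scale ast \<omega>2 t))"

definition trivial_infinitesimal_deformation ::
  "('k::field \<Rightarrow> 'g::ab_group_add \<Rightarrow> 'g) \<Rightarrow> ('g \<Rightarrow> 'g \<Rightarrow> 'g) \<Rightarrow> ('g \<Rightarrow> 'g \<Rightarrow> 'g)
    \<Rightarrow> ('g \<Rightarrow> 'g \<Rightarrow> 'g) \<Rightarrow> ('g \<Rightarrow> 'g \<Rightarrow> 'g) \<Rightarrow> bool"
  where "trivial_infinitesimal_deformation scale dot ast \<omega>1 \<omega>2 \<longleftrightarrow>
    generates_infinitesimal_deformation scale dot ast \<omega>1 \<omega>2 \<and>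
    (\<exists>N'. Vector_Spaces.linear scale scale N' \<and>
      (\<forall>t. compatible_pre_Lie_hom scale
             (deformed_product scale dot \<omega>1 t) (deformed_product scale ast \<omega>2 t)
             scale dot ast (\<lambda>x. x + scale t (N' x))))"

definition Nijenhuis_operator ::
  "('k::field \<Rightarrow> 'g::ab_group_add \<Rightarrow> 'g) \<Rightarrow> ('g \<Rightarrow> 'g \<Rightarrow> 'g) \<Rightarrow> ('g \<Rightarrow> 'g) \<Rightarrow> bool"
  where "Nijenhuis_operator scale m N \<longleftrightarrow>
    Vector_Spaces.linear scale scale N \<and>
    (\<forall>x y. m (N x) (N y) = N (m (N x) y + m x (N y) - N (m x y)))"

definition compatible_Nijenhuis_operator ::
  "('k::field \<Rightarrow> 'g::ab_group_add \<Rightarrow> 'g) \<Rightarrow> ('g \<Rightarrow> 'g \<Rightarrow> 'g) \<Rightarrow> ('g \<Rightarrow> 'g \<Rightarrow> 'g)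
    \<Rightarrow> ('g \<Rightarrow> 'g) \<Rightarrow> bool"
  where "compatible_Nijenhuis_operator scale dot ast N \<longleftrightarrow>
    Nijenhuis_operator scale dot N \<and> Nijenhuis_operator scale ast N"

end

theory Submission
  imports Defs
begin

text \<open>
  Both the pre-Lie identity and the compatibility condition are expressed by one expression
  \<open>D a b x y z\<close>, bilinear in the two products: \<open>a\<close> is pre-Lie iff \<open>D a a = 0\<close>, and \<open>a\<close>, \<open>b\<close> are
  compatible iff \<open>D a b + D b a = 0\<close>. Working with \<open>D a a\<close> instead of the polarised sum avoids a
  division by 2. Let \<open>T\<^sub>1, T\<^sub>2, T\<^sub>3\<close> be \<open>N\<close> acting on the three arguments of \<open>D a b\<close>. Writing
  \<open>a'\<close>, \<open>b'\<close> for the deformation terms, the coefficient of \<open>t\<close> in \<open>D (a + t a') (b + t b')\<close> is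
  \<open>(T\<^sub>1 + T\<^sub>2 + T\<^sub>3 - N) (D a b)\<close> for every linear \<open>N\<close>, and the Nijenhuis condition makes the
  coefficient of \<open>t\<^sup>2\<close> equal to \<open>(T\<^sub>1 T\<^sub>2 + T\<^sub>1 T\<^sub>3 + T\<^sub>2 T\<^sub>3 - N (T\<^sub>1 + T\<^sub>2 + T\<^sub>3) + N\<^sup>2) (D a b)\<close>.
  Both are linear in \<open>D a b\<close>, so they vanish along with the identities of the original products.
  The deformation is trivialised by \<open>N\<close> itself.
\<close>

definition pre_Lie_defect ::
  "('g::ab_group_add \<Rightarrow> 'g \<Rightarrow> 'g) \<Rightarrow> ('g \<Rightarrow> 'g \<Rightarrow> 'g) \<Rightarrow> 'g \<Rightarrow> 'g \<Rightarrow> 'g \<Rightarrow> 'g"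
  where "pre_Lie_defect a b x y z = a (b x y) z - a x (b y z) - a (b y x) z + a y (b x z)"

definition Nijenhuis_product ::
  "('g::ab_group_add \<Rightarrow> 'g) \<Rightarrow> ('g \<Rightarrow> 'g \<Rightarrow> 'g) \<Rightarrow> 'g \<Rightarrow> 'g \<Rightarrow> 'g"
  where "Nijenhuis_product N m x y = m (N x) y + m x (N y) - N (m x y)"

context bilinear_operation
begin

lemma add_left: "m (x + y) z = m x z + m y z"
  and scale_left: "m (scale c x) z = scale c (m x z)"
  and diff_left: "m (x - y) z = m x z - m y z"
proof -
  interpret l: Vector_Spaces.linear scale scale "\<lambda>x. m x z" by (rule linear_left)
  show "m (x + y) z = m x z + m y z" "m (scale c x) z = scale c (m x z)"
    "m (x - y) z = m x z - m y z"
    by (rule l.add l.scale l.diff)+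
qed

lemma add_right: "m z (x + y) = m z x + m z y"
  and scale_right: "m z (scale c x) = scale c (m z x)"
  and diff_right: "m z (x - y) = m z x - m z y"
proof -
  interpret r: Vector_Spaces.linear scale scale "\<lambda>x. m z x" by (rule linear_right)
  show "m z (x + y) = m z x + m z y" "m z (scale c x) = scale c (m z x)"
    "m z (x - y) = m z x - m z y"
    by (rule r.add r.scale r.diff)+
qed

end

lemma (in vector_space) bilinear_operationI:
  assumes "\<And>x y z. m (x + y) z = m x z + m y z" "\<And>c x z. m (scale c x) z = scale c (m x z)"
    and "\<And>x y z. m z (x + y) = m z x + m z y" "\<And>c x z. m z (scale c x) = scale c (m z x)"
  shows "bilinear_operation scale m"
  by unfold_locales (simp_all add: assms)

lemma bilinear_operation_Nijenhuis_product:
  assumes "bilinear_operation scale m" "Vector_Spaces.linear scale scale N"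
  shows "bilinear_operation scale (Nijenhuis_product N m)"
proof -
  interpret bilinear_operation scale m by fact
  interpret N: Vector_Spaces.linear scale scale N by fact
  show ?thesis
    by (rule bilinear_operationI)
      (simp_all add: Nijenhuis_product_def add_left add_right scale_left scale_right N.add N.scale
        scale_right_distrib scale_right_diff_distrib)
qed

lemma bilinear_operation_deformed_product:
  assumes "bilinear_operation scale m" "bilinear_operation scale w"
  shows "bilinear_operation scale (deformed_product scale m w t)"
proof -
  interpret bilinear_operation scale m by fact
  interpret w: bilinear_operation scale w by fact
  show ?thesis
    by (rule bilinear_operationI)
      (simp_all add: deformed_product_def add_left add_right scale_left scale_right w.add_left
        w.add_right w.scale_left w.scale_right scale_right_distrib scale_left_commute)
qed

lemma pre_Lie_algebra_iff_defect:
  "pre_Lie_algebra scale m \<longleftrightarrow>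
    bilinear_operation scale m \<and> (\<forall>x y z. pre_Lie_defect m m x y z = 0)"
  unfolding pre_Lie_algebra_def pre_Lie_algebra_axioms_def pre_Lie_defect_def
  by (simp add: algebra_simps)

lemma compatible_pre_Lie_algebra_iff_defect:
  "compatible_pre_Lie_algebra scale a b \<longleftrightarrow>
    pre_Lie_algebra scale a \<and> pre_Lie_algebra scale b \<and>
    (\<forall>x y z. pre_Lie_defect a b x y z + pre_Lie_defect b a x y z = 0)"
  unfolding compatible_pre_Lie_algebra_def compatible_pre_Lie_algebra_axioms_def
    pre_Lie_defect_def
  by (simp add: algebra_simps)

text \<open>The inner products \<open>b\<close> and \<open>v\<close> occur only as values fed to the
  outer ones, so the expansion in powers of \<open>t\<close> rests on the linearity of
  \<open>a\<close> and \<open>u\<close> in each argument.\<close>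

lemma pre_Lie_defect_deformed_product:
  assumes "bilinear_operation scale a" "bilinear_operation scale u"
  shows "pre_Lie_defect (deformed_product scale a u t) (deformed_product scale b v t) x y z =
    pre_Lie_defect a b x y z
    + scale t (pre_Lie_defect u b x y z + pre_Lie_defect a v x y z)
    + scale (t * t) (pre_Lie_defect u v x y z)"
proof -
  interpret a: bilinear_operation scale a by fact
  interpret u: bilinear_operation scale u by fact
  show ?thesis
    by (simp add: pre_Lie_defect_def deformed_product_def a.add_left a.add_right a.scale_left
        a.scale_right u.add_left u.add_right u.scale_left u.scale_right
        a.scale_right_distrib a.scale_right_diff_distrib algebra_simps)
qed

text \<open>For the bracketing \<open>a (b u v) w\<close>, deforming the outer product yields
  \<open>a (N (b u v)) w\<close> and deforming the inner one yields its negative. Once these cancel,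
  \<open>N\<close> acts only on the three arguments and on the final value;
  \<open>a u (b v w)\<close> behaves in the same way.\<close>

lemma pre_Lie_defect_Nijenhuis_first_order:
  assumes "bilinear_operation scale a" "Vector_Spaces.linear scale scale N"
  shows "pre_Lie_defect (Nijenhuis_product N a) b x y z
      + pre_Lie_defect a (Nijenhuis_product N b) x y z =
    pre_Lie_defect a b (N x) y z + pre_Lie_defect a b x (N y) z + pre_Lie_defect a b x y (N z)
    - N (pre_Lie_defect a b x y z)"
proof -
  interpret a: bilinear_operation scale a by fact
  interpret N: Vector_Spaces.linear scale scale N by fact
  show ?thesis
    by (simp add: pre_Lie_defect_def Nijenhuis_product_def a.add_left a.add_right a.diff_left
        a.diff_right N.add N.diff algebra_simps)
qed

text \<open>The formula already holds for each of the bracketings \<open>a (b u v) w\<close> and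
  \<open>a u (b v w)\<close> by itself; the defect is a signed sum of four such terms.\<close>

lemma pre_Lie_defect_Nijenhuis_second_order:
  assumes "bilinear_operation scale a" "Nijenhuis_operator scale a N" "Nijenhuis_operator scale b N"
  shows "pre_Lie_defect (Nijenhuis_product N a) (Nijenhuis_product N b) x y z =
    pre_Lie_defect a b (N x) (N y) z + pre_Lie_defect a b (N x) y (N z)
    + pre_Lie_defect a b x (N y) (N z)
    - N (pre_Lie_defect a b (N x) y z + pre_Lie_defect a b x (N y) z
         + pre_Lie_defect a b x y (N z))
    + N (N (pre_Lie_defect a b x y z))"
proof -
  interpret a: bilinear_operation scale a by fact
  interpret N: Vector_Spaces.linear scale scale N
    using assms(2) by (simp add: Nijenhuis_operator_def)
  have a: "a (N u) (N v) = N (a (N u) v) + N (a u (N v)) - N (N (a u v))" for u v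
    using assms(2) by (simp add: Nijenhuis_operator_def N.add N.diff)
  have b: "N (Nijenhuis_product N b u v) = b (N u) (N v)" for u v
    using assms(3) by (simp add: Nijenhuis_operator_def Nijenhuis_product_def)
  \<comment> \<open>Fact \<open>b\<close> treats the summand in which the outer product applies
    \<open>N\<close> to the inner value. With \<open>p = b u v\<close>, the remaining terms
    \<open>- a (N p) (N w) + N (a (N p) w)\<close> become
    \<open>- N (a p (N w)) + N (N (a p w))\<close> by fact \<open>a\<close>.\<close>
  have left: "Nijenhuis_product N a (Nijenhuis_product N b u v) w =
      a (b (N u) (N v)) w + a (b (N u) v) (N w) + a (b u (N v)) (N w)
      - N (a (b (N u) v) w + a (b u (N v)) w + a (b u v) (N w)) + N (N (a (b u v) w))" for u v w
    unfolding Nijenhuis_product_def[of N a] b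
    unfolding Nijenhuis_product_def[of N b]
    by (simp add: a.add_left a.diff_left N.add N.diff a[of "b u v" w])
  have right: "Nijenhuis_product N a u (Nijenhuis_product N b v w) =
      a (N u) (b (N v) w) + a (N u) (b v (N w)) + a u (b (N v) (N w))
      - N (a (N u) (b v w) + a u (b (N v) w) + a u (b v (N w))) + N (N (a u (b v w)))" for u v w
    unfolding Nijenhuis_product_def[of N a] b
    unfolding Nijenhuis_product_def[of N b]
    by (simp add: a.add_right a.diff_right N.add N.diff a[of u "b v w"])
  show ?thesis
    unfolding pre_Lie_defect_def left right
    by (simp add: N.add N.diff algebra_simps)
qed

lemma compatible_pre_Lie_algebra_Nijenhuis_deformation:
  assumes "compatible_pre_Lie_algebra scale a b" "compatible_Nijenhuis_operator scale a b N"
  shows "compatible_pre_Lie_algebra scale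
    (deformed_product scale a (Nijenhuis_product N a) t)
    (deformed_product scale b (Nijenhuis_product N b) t)"
proof -
  interpret compatible_pre_Lie_algebra scale a b by fact
  have Na: "Nijenhuis_operator scale a N" and Nb: "Nijenhuis_operator scale b N"
    using assms(2) by (simp_all add: compatible_Nijenhuis_operator_def)
  then have N_linear: "Vector_Spaces.linear scale scale N"
    by (simp add: Nijenhuis_operator_def)
  interpret N: Vector_Spaces.linear scale scale N by fact
  note bilinear = dot.bilinear_operation_axioms ast.bilinear_operation_axioms
  note bilinear' = bilinear[THEN bilinear_operation_Nijenhuis_product, OF N_linear]
  \<comment> \<open>All arguments are covered because the defects are also evaluated at images under
    \<open>N\<close>. The orientation of \<open>ab\<close> turns the mixed sums into terms in
    \<open>pre_Lie_defect a b\<close>, which cancel in pairs.\<close>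
  have aa: "pre_Lie_defect a a x y z = 0" and bb: "pre_Lie_defect b b x y z = 0"
    and ab: "pre_Lie_defect b a x y z = - pre_Lie_defect a b x y z" for x y z
    using assms(1)
    by (simp_all add: compatible_pre_Lie_algebra_iff_defect pre_Lie_algebra_iff_defect
        eq_neg_iff_add_eq_0 add.commute)
  note deformed = pre_Lie_defect_deformed_product[OF bilinear(1) bilinear'(1)]
    pre_Lie_defect_deformed_product[OF bilinear(2) bilinear'(2)]
  note first = bilinear[THEN pre_Lie_defect_Nijenhuis_first_order, OF N_linear]
  note second = pre_Lie_defect_Nijenhuis_second_order[OF bilinear(1) Na]
    pre_Lie_defect_Nijenhuis_second_order[OF bilinear(2) Nb]
  show ?thesis
    unfolding compatible_pre_Lie_algebra_iff_defect pre_Lie_algebra_iff_defect deformed first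
      second[OF Na] second[OF Nb] aa bb ab
    by (simp add: bilinear bilinear' bilinear_operation_deformed_product N.zero N.neg N.add N.diff
        dot.scale_right_distrib dot.scale_right_diff_distrib algebra_simps)
qed

text \<open>Compare powers of \<open>t\<close>: at first order \<open>N (m x y)\<close> cancels
  against the last term of \<open>Nijenhuis_product\<close>, and at second order the claim is the
  Nijenhuis condition.\<close>

lemma Nijenhuis_deformation_hom:
  assumes "bilinear_operation scale m" "Nijenhuis_operator scale m N"
  shows "deformed_product scale m (Nijenhuis_product N m) t x y
      + scale t (N (deformed_product scale m (Nijenhuis_product N m) t x y)) =
    m (x + scale t (N x)) (y + scale t (N y))"
proof -
  interpret bilinear_operation scale m by fact
  interpret N: Vector_Spaces.linear scale scale N
    using assms(2) by (simp add: Nijenhuis_operator_def)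
  have "N (Nijenhuis_product N m x y) = m (N x) (N y)"
    using assms(2) by (simp add: Nijenhuis_operator_def Nijenhuis_product_def)
  \<comment> \<open>The first simplification keeps \<open>Nijenhuis_product\<close> folded so that
    the Nijenhuis condition can rewrite the second-order term; only then is the definition
    expanded.\<close>
  then show ?thesis
    by (simp add: deformed_product_def N.add N.scale)
      (simp add: Nijenhuis_product_def add_left add_right scale_left scale_right
        scale_right_distrib scale_right_diff_distrib algebra_simps)
qed

theorem theorem3p13:
  fixes scale :: "'k::field \<Rightarrow> 'g::ab_group_add \<Rightarrow> 'g"
    and dot ast \<omega>1 \<omega>2 :: "'g \<Rightarrow> 'g \<Rightarrow> 'g"
    and N :: "'g \<Rightarrow> 'g"
  assumes "compatible_pre_Lie_algebra scale dot ast"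
    and "compatible_Nijenhuis_operator scale dot ast N"
    and "\<And>x y. \<omega>1 x y = dot (N x) y + dot x (N y) - N (dot x y)"
    and "\<And>x y. \<omega>2 x y = ast (N x) y + ast x (N y) - N (ast x y)"
  shows "generates_infinitesimal_deformation scale dot ast \<omega>1 \<omega>2 \<and>
         trivial_infinitesimal_deformation scale dot ast \<omega>1 \<omega>2"
proof -
  interpret compatible_pre_Lie_algebra scale dot ast by fact
  have \<omega>: "\<omega>1 = Nijenhuis_product N dot" "\<omega>2 = Nijenhuis_product N ast"
    using assms(3,4) by (auto simp: fun_eq_iff Nijenhuis_product_def)
  have Nijenhuis: "Nijenhuis_operator scale dot N" "Nijenhuis_operator scale ast N"
    using assms(2) by (simp_all add: compatible_Nijenhuis_operator_def)
  then have N_linear: "Vector_Spaces.linear scale scale N"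
    by (simp add: Nijenhuis_operator_def)
  interpret N: Vector_Spaces.linear scale scale N by fact
  note bilinear = dot.bilinear_operation_axioms ast.bilinear_operation_axioms
  have deformation: "compatible_pre_Lie_algebra scale
      (deformed_product scale dot \<omega>1 t) (deformed_product scale ast \<omega>2 t)" for t
    unfolding \<omega> using assms(1,2) by (rule compatible_pre_Lie_algebra_Nijenhuis_deformation)
  then have generates: "generates_infinitesimal_deformation scale dot ast \<omega>1 \<omega>2"
    unfolding generates_infinitesimal_deformation_def \<omega>
    using bilinear[THEN bilinear_operation_Nijenhuis_product, OF N_linear] by blast
  have "compatible_pre_Lie_hom scale (deformed_product scale dot \<omega>1 t)
      (deformed_product scale ast \<omega>2 t) scale dot ast (\<lambda>x. x + scale t (N x))" for t
  proof -
    have "Vector_Spaces.linear scale scale (\<lambda>x. x + scale t (N x))"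
      by (simp add: Vector_Spaces.linear_iff dot.vector_space_axioms N.add N.scale
          dot.scale_right_distrib dot.scale_left_commute algebra_simps)
    then show ?thesis
      \<comment> \<open>The homomorphism locale also asks that source and target be compatible
        pre-Lie algebras: \<open>deformation\<close> supplies the source, the first assumption the
        target.\<close>
      unfolding compatible_pre_Lie_hom_def compatible_pre_Lie_hom_axioms_def
      using deformation assms(1) bilinear[THEN Nijenhuis_deformation_hom] Nijenhuis
      by (simp add: \<omega>)
  qed
  with generates N_linear show ?thesis
    unfolding trivial_infinitesimal_deformation_def by blast
qed

end
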